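(* Let $X_1,X_2,\dots$ be i.i.d. with a monotone decreasing probability mass function $p$ on $\mathbb N$. Then all three estimators $\widehat p_n$, $\widehat p_n^G$ and $\widehat p_n^R$ are consistent, in the sense that $$\rho(\tilde p_n,p)\to0\quad\text{almost surely as }n\to\infty$$ for $\tilde p_n=\widehat p_n,\widehat p_n^G$ and $\widehat p_n^R$, whenever $\rho(\tilde p,p)=H(\tilde p,p)$ or $\rho(\tilde p,p)=\|\tilde p-p\|_k$ with $1\le k\le\infty$.
   Context: $\mathbb N=\{0,1,2,\dots\}$. A probability mass function $p=(p_x)_{x\in\mathbb N}$ is monotone decreasing if $p_x\ge p_{x+1}$ for all $x\in\mathbb N$. The empirical estimator is $\widehat p_{n,x}=n^{-1}\#\{i\le n:X_i=x\}$. For a finite vector $w=(w_0,\dots,w_k)$, $\mathrm{rear}(w)$ is the vector of entries of $w$ sorted in nonincreasing order, and $\mathrm{gren}(w)$ is the vector of the $k+1$ left slopes, at $j=0,\dots,k$, of the least concave majorant of the points $\{(j,\sum_{i=0}^jw_i):j=-1,0,\dots,k\}$ (empty sum $=0$). The rearrangement estimator is $\widehat p_n^R=\mathrm{rear}(\widehat p_n)$ and the Grenander estimator (MLE) is $\widehat p_n^G=\mathrm{gren}(\widehat p_n)$; both operators are applied to the finite vector $(\widehat p_{n,x})_{0\le x\le\max_{i\le n}X_i}$, and the results are extended by $0$ to $\mathbb N$. Metrics: $H^2(p,\tilde p)=\frac12\sum_{x\ge0}(\sqrt{p_x}-\sqrt{\tilde p_x})^2$ (Hellinger, $H\ge0$);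 $\|v\|_k=(\sum_{x\ge0}|v_x|^k)^{1/k}$ for $1\le k<\infty$ and $\|v\|_\infty=\sup_{x\ge0}|v_x|$. *)

theory Defs
  imports "HOL-Probability.Probability"
begin

text \<open>
  Finite vectors \<open>(w\<^sub>0, \<dots>, w\<^sub>k)\<close> are lists of length \<open>k + 1\<close>; a realised sample
  \<open>x\<^sub>1, x\<^sub>2, \<dots>\<close> is a function \<open>xs :: nat \<Rightarrow> nat\<close> of which only the values at indices
  at least 1 are used.
\<close>

subsection \<open>Rearrangement and Grenander operators\<close>

definition rear :: "real list \<Rightarrow> real list" where
  "rear w = rev (sort w)"

text \<open>
  The least concave majorant of a set of points in the plane, as the pointwise infimum of all
  concave majorants. It is only meaningful on the convex hull of the abscissae.
\<close>

definition least_concave_majorant :: "(real \<times> real) set \<Rightarrow> real \<Rightarrow> real" where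
  "least_concave_majorant P t =
     Inf {g t | g. concave_on (convex hull (fst ` P)) g \<and> (\<forall>(a, b)\<in>P. b \<le> g a)}"

definition left_slope :: "(real \<Rightarrow> real) \<Rightarrow> real \<Rightarrow> real" where
  "left_slope f t = Lim (at_left t) (\<lambda>s. (f t - f s) / (t - s))"

text \<open>
  The points \<open>(j, w\<^sub>0 + \<dots> + w\<^sub>j)\<close> for \<open>j = -1, 0, \<dots>, k\<close> are indexed by \<open>m = j + 1\<close>.
\<close>

definition cumsum_points :: "real list \<Rightarrow> (real \<times> real) set" where
  "cumsum_points w = {(real m - 1, \<Sum>i<m. w ! i) | m. m \<le> length w}"

definition gren :: "real list \<Rightarrow> real list" where
  "gren w = map (\<lambda>j. left_slope (least_concave_majorant (cumsum_points w)) (real j))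
     [0..<length w]"

subsection \<open>The three estimators\<close>

definition empirical :: "nat \<Rightarrow> (nat \<Rightarrow> nat) \<Rightarrow> nat \<Rightarrow> real" where
  "empirical n xs x = real (card {i \<in> {1..n}. xs i = x}) / real n"

text \<open>For \<open>n = 0\<close> the maximum is taken over the empty set and the value is irrelevant.\<close>

definition empirical_vec :: "nat \<Rightarrow> (nat \<Rightarrow> nat) \<Rightarrow> real list" where
  "empirical_vec n xs = map (empirical n xs) [0..<Suc (Max (xs ` {1..n}))]"

definition extend_zero :: "real list \<Rightarrow> nat \<Rightarrow> real" where
  "extend_zero w x = (if x < length w then w ! x else 0)"

definition rearrangement :: "nat \<Rightarrow> (nat \<Rightarrow> nat) \<Rightarrow> nat \<Rightarrow> real" where
  "rearrangement n xs = extend_zero (rear (empirical_vec n xs))"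

definition grenander :: "nat \<Rightarrow> (nat \<Rightarrow> nat) \<Rightarrow> nat \<Rightarrow> real" where
  "grenander n xs = extend_zero (gren (empirical_vec n xs))"

subsection \<open>Metrics\<close>

text \<open>
  The series and the supremum below are taken in the reals; they are genuine when the two
  arguments of the Hellinger distance are nonnegative and summable, and when the argument of
  the norm is absolutely summable.
\<close>

definition hellinger :: "(nat \<Rightarrow> real) \<Rightarrow> (nat \<Rightarrow> real) \<Rightarrow> real" where
  "hellinger q p = sqrt (1 / 2 * (\<Sum>x. (sqrt (q x) - sqrt (p x))\<^sup>2))"

definition lk_norm :: "ereal \<Rightarrow> (nat \<Rightarrow> real) \<Rightarrow> real" where
  "lk_norm k v =
     (if k = \<infinity> then (SUP x. \<bar>v x\<bar>)
      else (\<Sum>x. \<bar>v x\<bar> powr real_of_ereal k) powr (1 / real_of_ereal k))"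

end

theory Submission
  imports Defs
begin

text \<open>
  Almost surely the empirical frequencies converge pointwise to \<open>p\<close>, by Hoeffding's inequality and
  the Borel-Cantelli lemma. Pointwise convergence of probability vectors to a probability vector is
  convergence in \<open>\<ell>\<^sub>1\<close> (Scheffe), and the \<open>\<ell>\<^sub>1\<close> distance controls the Hellinger distance and all
  \<open>\<ell>\<^sub>k\<close> distances. For monotone \<open>p\<close>, rearranging does not increase the supremum distance to \<open>p\<close>, and
  taking least concave majorants does not increase the supremum distance to the concave cumulative
  sums of \<open>p\<close>. Both are bounded by the \<open>\<ell>\<^sub>1\<close> error of the empirical estimator, so the other two
  estimators converge pointwise as well, and Scheffe applies to them again.
\<close>

subsection \<open>Convergence in \<open>\<ell>\<^sub>1\<close> and the metrics\<close>

text \<open>Scheffe's argument: \<open>max (r x - q n x) 0\<close> is dominated by the summable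
  \<open>r\<close>, so its sum tends to 0 by dominated convergence. As both totals equal
  \<open>c\<close>, the l1 distance is twice that sum.\<close>

lemma tendsto_l1_of_pointwise:
  fixes q :: "nat \<Rightarrow> nat \<Rightarrow> real" and r :: "nat \<Rightarrow> real"
  assumes q_nonneg: "\<forall>\<^sub>F n in sequentially. \<forall>x. 0 \<le> q n x"
    and q_sums: "\<forall>\<^sub>F n in sequentially. q n sums c"
    and r_nonneg: "\<And>x. 0 \<le> r x" and r_sums: "r sums c"
    and lim: "\<And>x. (\<lambda>n. q n x) \<longlonglongrightarrow> r x"
  shows "(\<lambda>n. \<Sum>x. \<bar>q n x - r x\<bar>) \<longlonglongrightarrow> 0"
proof -
  have pos_part: "(\<lambda>n. \<Sum>x. max (r x - q n x) 0) \<longlonglongrightarrow> (\<Sum>x. max (r x - r x) 0)"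
  proof (rule tannerys_theorem[THEN conjunct2, THEN conjunct2])
    show "(\<lambda>n. max (r x - q n x) 0) \<longlonglongrightarrow> max (r x - r x) 0" for x
      by (intro tendsto_intros lim)
    show "\<forall>\<^sub>F (k, n) in at_top \<times>\<^sub>F sequentially. norm (max (r k - q n k) 0) \<le> r k"
      unfolding eventually_prod_filter
      using q_nonneg r_nonneg
      by (intro exI[of _ "\<lambda>_. True"] exI[of _ "\<lambda>n. \<forall>x. 0 \<le> q n x"]) auto
    show "summable r" using r_sums by (rule sums_summable)
  qed auto
  have "\<forall>\<^sub>F n in sequentially. 2 * (\<Sum>x. max (r x - q n x) 0) = (\<Sum>x. \<bar>q n x - r x\<bar>)"
    using q_nonneg q_sums
  proof eventually_elim
    case (elim n)
    have "summable (\<lambda>x. max (r x - q n x) 0)"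
      using elim r_nonneg by (intro summable_comparison_test'[OF sums_summable[OF r_sums]]) auto
    from sums_add[OF sums_diff[OF elim(2) r_sums] sums_mult[OF summable_sums[OF this], of 2]]
    have "(\<lambda>x. q n x - r x + 2 * max (r x - q n x) 0) sums (2 * (\<Sum>x. max (r x - q n x) 0))"
      by simp
    also have "(\<lambda>x. q n x - r x + 2 * max (r x - q n x) 0) = (\<lambda>x. \<bar>q n x - r x\<bar>)"
      by (auto simp: fun_eq_iff max_def)
    finally show ?case by (rule sums_unique)
  qed
  moreover have "(\<lambda>n. 2 * (\<Sum>x. max (r x - q n x) 0)) \<longlonglongrightarrow> 0"
    using tendsto_mult[OF tendsto_const[of 2] pos_part] by simp
  ultimately show ?thesis by (rule Lim_transform_eventually[rotated])
qed

text \<open>No entry exceeds the l1 norm \<open>S\<close>, hence \<open>\<bar>v x\<bar> powr r \<le>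
  S powr (r - 1) * \<bar>v x\<bar>\<close>, and summing over \<open>x\<close> gives
  \<open>S powr r\<close>.\<close>

lemma lk_norm_le_l1:
  assumes sv: "summable (\<lambda>x. \<bar>v x\<bar>)" and k: "1 \<le> k"
  shows "0 \<le> lk_norm k v \<and> lk_norm k v \<le> (\<Sum>x. \<bar>v x\<bar>)"
proof -
  define S where "S = (\<Sum>x. \<bar>v x\<bar>)"
  have le: "\<bar>v x\<bar> \<le> S" for x
    unfolding S_def using sum_le_suminf[OF sv, of "{x}"] by simp
  then have S0: "0 \<le> S" using order_trans[OF abs_ge_zero] by blast
  show ?thesis
  proof (cases "k = \<infinity>")
    case True
    have "bdd_above (range (\<lambda>x. \<bar>v x\<bar>))" using le by (auto intro!: bdd_aboveI)
    then have "\<bar>v 0\<bar> \<le> (SUP x. \<bar>v x\<bar>)" by (rule cSUP_upper[rotated]) simp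
    moreover have "(SUP x. \<bar>v x\<bar>) \<le> S" using le by (intro cSUP_least) auto
    ultimately show ?thesis using True by (auto simp: lk_norm_def S_def)
  next
    case False
    then obtain r where r: "k = ereal r" "1 \<le> r" using k by (cases k) auto
    have term_le: "\<bar>v x\<bar> powr r \<le> S powr (r - 1) * \<bar>v x\<bar>" for x
    proof (cases "v x = 0")
      case False
      then have "\<bar>v x\<bar> powr r = \<bar>v x\<bar> powr (r - 1) * \<bar>v x\<bar>"
        by (simp add: powr_diff)
      also have "\<dots> \<le> S powr (r - 1) * \<bar>v x\<bar>"
        using r le by (intro mult_right_mono powr_mono2) auto
      finally show ?thesis .
    qed simp
    have summ: "summable (\<lambda>x. \<bar>v x\<bar> powr r)"
      using term_le by (intro summable_comparison_test'[OF summable_mult[OF sv]]) auto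
    have "(\<Sum>x. \<bar>v x\<bar> powr r) \<le> (\<Sum>x. S powr (r - 1) * \<bar>v x\<bar>)"
      by (intro suminf_le term_le summ summable_mult sv)
    also have "\<dots> = S powr (r - 1) * S" unfolding S_def by (rule suminf_mult[OF sv])
    also have "\<dots> = S powr r" using S0 by (cases "S = 0") (auto simp: powr_diff)
    finally have "(\<Sum>x. \<bar>v x\<bar> powr r) powr (1 / r) \<le> (S powr r) powr (1 / r)"
      using r by (intro powr_mono2) (auto intro!: suminf_nonneg summ)
    also have "\<dots> = S" using S0 r by (simp add: powr_powr)
    finally show ?thesis using False r by (simp add: lk_norm_def S_def)
  qed
qed

text \<open>The difference of two square roots is at most their sum in absolute value, and the
  product of difference and sum is \<open>q x - p x\<close>.\<close>

lemma hellinger_le_l1: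
  assumes q: "\<And>x. 0 \<le> q x" and p: "\<And>x. 0 \<le> p x" and s: "summable (\<lambda>x. \<bar>q x - p x\<bar>)"
  shows "0 \<le> hellinger q p \<and> hellinger q p \<le> sqrt (\<Sum>x. \<bar>q x - p x\<bar>)"
proof -
  have le: "(sqrt (q x) - sqrt (p x))\<^sup>2 \<le> \<bar>q x - p x\<bar>" for x
  proof -
    have "\<bar>sqrt (q x) - sqrt (p x)\<bar> * \<bar>sqrt (q x) - sqrt (p x)\<bar>
        \<le> \<bar>sqrt (q x) - sqrt (p x)\<bar> * \<bar>sqrt (q x) + sqrt (p x)\<bar>"
      using real_sqrt_ge_zero[OF q, of x] real_sqrt_ge_zero[OF p, of x]
      by (intro mult_left_mono) linarith+
    also have "\<dots> = \<bar>q x - p x\<bar>"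
      unfolding abs_mult[symmetric] using q[of x] p[of x] by (simp add: algebra_simps)
    finally show ?thesis by (simp add: power2_eq_square)
  qed
  have summ: "summable (\<lambda>x. (sqrt (q x) - sqrt (p x))\<^sup>2)"
    using le by (intro summable_comparison_test'[OF s]) auto
  have "(\<Sum>x. (sqrt (q x) - sqrt (p x))\<^sup>2) \<le> (\<Sum>x. \<bar>q x - p x\<bar>)"
    by (intro suminf_le le summ s)
  moreover have "0 \<le> (\<Sum>x. (sqrt (q x) - sqrt (p x))\<^sup>2)"
    by (intro suminf_nonneg summ) auto
  ultimately show ?thesis by (simp add: hellinger_def)
qed

subsection \<open>Strong law for the empirical frequencies\<close>

lemma empirical_tendsto_AE:
  fixes M :: "'a measure" and X :: "nat \<Rightarrow> 'a \<Rightarrow> nat" and p :: "nat pmf"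
  assumes "prob_space M"
    and indep: "prob_space.indep_vars M (\<lambda>_. count_space UNIV) X {1..}"
    and distr: "\<And>i. i \<ge> 1 \<Longrightarrow> distr M (count_space UNIV) (X i) = measure_pmf p"
  shows "AE \<omega> in M. \<forall>x. (\<lambda>n. empirical n (\<lambda>i. X i \<omega>) x) \<longlonglongrightarrow> pmf p x"
proof -
  interpret prob_space M by fact
  have meas: "X i \<in> measurable M (count_space UNIV)" if "i \<ge> 1" for i
    using indep that unfolding indep_vars_def by auto
  have close: "AE \<omega> in M. \<forall>\<^sub>F n in sequentially. \<bar>empirical n (\<lambda>i. X i \<omega>) x - pmf p x\<bar> < \<epsilon>"
    if \<epsilon>: "\<epsilon> > 0" for x \<epsilon>
  proof -
    define Z :: "nat \<Rightarrow> 'a \<Rightarrow> real" where "Z i \<omega> = indicator {x} (X i \<omega>)" for i \<omega>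
    have Z_meas[measurable]: "Z i \<in> borel_measurable M" if "i \<ge> 1" for i
      unfolding Z_def[abs_def] by (rule measurable_compose[OF meas[OF that]]) simp
    have Z_distr: "distr M borel (Z i) = distr (measure_pmf p) borel (indicator {x})" if "i \<ge> 1" for i
      unfolding distr[OF that, symmetric] using meas[OF that]
      by (subst distr_distr) (auto simp: Z_def[abs_def] comp_def)
    have Z_mean: "expectation (Z 1) = pmf p x"
    proof -
      have "expectation (Z 1) = (\<integral>y. indicator {x} y \<partial>distr M (count_space UNIV) (X 1))"
        using meas[of 1] by (subst integral_distr) (auto simp: Z_def[abs_def])
      then show ?thesis by (simp add: distr measure_pmf_single)
    qed
    have emp: "empirical n (\<lambda>i. X i \<omega>) x = (\<Sum>i\<in>{1..n}. Z i \<omega>) / real n" for n \<omega>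
    proof -
      have "{i \<in> {1..n}. X i \<omega> = x} = {1..n} \<inter> {i. X i \<omega> = x}" by auto
      then show ?thesis
        unfolding empirical_def Z_def by (simp add: indicator_def sum.If_cases)
    qed
    \<comment> \<open>The shift to \<open>Suc n\<close> keeps the denominator positive; it is undone
      by \<open>eventually_sequentially_Suc\<close>.\<close>
    define A where "A n = {\<omega> \<in> space M. \<bar>(\<Sum>i\<in>{1..Suc n}. Z i \<omega>) / real (Suc n) - pmf p x\<bar> \<ge> \<epsilon>}" for n
    have A_meas: "A n \<in> sets M" for n unfolding A_def by measurable
    have A_prob: "prob (A n) \<le> 2 * exp (- 2 * \<epsilon>\<^sup>2) ^ Suc n" for n
    proof -
      \<comment> \<open>The indicators lie in an interval of length 1, so the tail bound is
        geometric in the sample size and therefore summable.\<close>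
      interpret Hoeffding_ineq_iid M "{1..Suc n}" Z "Z 1" 0 1 "pmf p x"
      proof unfold_locales
        show "indep_vars (\<lambda>_. borel) Z {1..Suc n}"
          unfolding Z_def[abs_def]
          by (rule indep_vars_compose2[OF indep_vars_subset[OF indep]]) auto
        show "pmf p x \<equiv> expectation (Z 1)" by (simp only: Z_mean)
      qed (auto simp: Z_distr, auto simp: Z_def indicator_def)
      have "prob (A n) \<le> 2 * exp (- 2 * real (Suc n) * \<epsilon>\<^sup>2)"
        using Hoeffding_ineq_abs_ge'[of \<epsilon>] \<epsilon> unfolding A_def by simp
      also have "exp (- 2 * real (Suc n) * \<epsilon>\<^sup>2) = exp (- 2 * \<epsilon>\<^sup>2) ^ Suc n"
        by (subst exp_of_nat_mult[symmetric]) (simp add: algebra_simps)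
      finally show ?thesis .
    qed
    have "summable (\<lambda>n. 2 * exp (- 2 * \<epsilon>\<^sup>2) ^ Suc n)"
      using \<epsilon> by (intro summable_mult) (simp only: summable_Suc_iff, intro summable_geometric, simp)
    then have "summable (\<lambda>n. prob (A n))"
      by (rule summable_comparison_test'[where N = 0]) (use A_prob in simp)
    then have "AE \<omega> in M. \<forall>\<^sub>F n in sequentially. \<omega> \<in> space M - A n"
      using A_meas by (intro borel_cantelli_AE1) (auto simp: emeasure_eq_measure)
    then show ?thesis
    proof (rule AE_mp, intro AE_I2 impI)
      fix \<omega> assume "\<omega> \<in> space M" "\<forall>\<^sub>F n in sequentially. \<omega> \<in> space M - A n"
      then have "\<forall>\<^sub>F n in sequentially. \<bar>empirical (Suc n) (\<lambda>i. X i \<omega>) x - pmf p x\<bar> < \<epsilon>"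
        by (auto simp: A_def emp elim!: eventually_mono)
      then show "\<forall>\<^sub>F n in sequentially. \<bar>empirical n (\<lambda>i. X i \<omega>) x - pmf p x\<bar> < \<epsilon>"
        by (subst eventually_sequentially_Suc[symmetric])
    qed
  qed
  \<comment> \<open>Countably many points and tolerances suffice, so the exceptional null sets can
    be united.\<close>
  have "AE \<omega> in M. \<forall>x. \<forall>m. \<forall>\<^sub>F n in sequentially.
      \<bar>empirical n (\<lambda>i. X i \<omega>) x - pmf p x\<bar> < inverse (real (Suc m))"
    unfolding AE_all_countable by (intro allI close) simp
  then show ?thesis
  proof (rule AE_mp, intro AE_I2 impI allI)
    fix \<omega> x
    assume *: "\<forall>x. \<forall>m. \<forall>\<^sub>F n in sequentially.
      \<bar>empirical n (\<lambda>i. X i \<omega>) x - pmf p x\<bar> < inverse (real (Suc m))"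
    show "(\<lambda>n. empirical n (\<lambda>i. X i \<omega>) x) \<longlonglongrightarrow> pmf p x"
    proof (rule tendstoI)
      fix e :: real assume "e > 0"
      then obtain m where m: "inverse (real (Suc m)) < e" using reals_Archimedean by blast
      from *[rule_format, of x m]
      show "\<forall>\<^sub>F n in sequentially. dist (empirical n (\<lambda>i. X i \<omega>) x) (pmf p x) < e"
        by eventually_elim (use m in \<open>auto simp: dist_real_def\<close>)
    qed
  qed
qed

subsection \<open>Rearrangement\<close>

text \<open>Sorting preserves the number of entries above any level. Monotonicity of
  \<open>p\<close> confines the entries of \<open>w\<close> above \<open>p x + \<epsilon>\<close> to
  the indices below \<open>x\<close>, and puts all entries up to index \<open>x\<close> at or above
  \<open>p x - \<epsilon>\<close>.\<close>

lemma rear_close: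
  assumes "antimono p" and close: "\<And>i. i < length w \<Longrightarrow> \<bar>w ! i - p i\<bar> \<le> \<epsilon>"
    and x: "x < length w"
  shows "\<bar>rear w ! x - p x\<bar> \<le> \<epsilon>"
proof -
  have len: "length (rear w) = length w" by (simp add: rear_def)
  have count: "card {i. i < length w \<and> P (rear w ! i)} = card {i. i < length w \<and> P (w ! i)}" for P
  proof -
    have "mset (rear w) = mset w" by (simp add: rear_def)
    then have "length (filter P (rear w)) = length (filter P w)"
      by (metis mset_filter size_mset)
    then show ?thesis by (simp add: length_filter_conv_card len)
  qed
  have mono: "rear w ! j \<le> rear w ! i" if "i \<le> j" "j < length w" for i j
    using that sorted_rev_nth_mono[of "rear w" i j] by (simp add: rear_def)
  have "rear w ! x \<le> p x + \<epsilon>"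
  proof (rule ccontr)
    assume "\<not> ?thesis"
    \<comment> \<open>A sorted entry that is too large at \<open>x\<close> forces
      \<open>x + 1\<close> large entries, but only \<open>x\<close> indices can carry them.\<close>
    then have "{..x} \<subseteq> {i. i < length w \<and> rear w ! i > p x + \<epsilon>}"
      using mono x by (force simp: not_le)
    then have "Suc x \<le> card {i. i < length w \<and> rear w ! i > p x + \<epsilon>}"
      using card_mono[of "{i. i < length w \<and> rear w ! i > p x + \<epsilon>}" "{..x}"] by simp
    also have "\<dots> = card {i. i < length w \<and> w ! i > p x + \<epsilon>}" by (rule count)
    also have "\<dots> \<le> card {..<x}"
    proof (intro card_mono subsetI)
      fix i assume "i \<in> {i. i < length w \<and> w ! i > p x + \<epsilon>}"
      then have "p x < p i" using close[of i] by auto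
      then show "i \<in> {..<x}" using antimonoD[OF \<open>antimono p\<close>, of x i] by force
    qed simp
    finally show False by simp
  qed
  moreover have "p x - \<epsilon> \<le> rear w ! x"
  proof (rule ccontr)
    assume less: "\<not> ?thesis"
    have "{..x} \<subseteq> {i. i < length w \<and> w ! i \<ge> p x - \<epsilon>}"
    proof
      fix i assume "i \<in> {..x}"
      then show "i \<in> {i. i < length w \<and> w ! i \<ge> p x - \<epsilon>}"
        using close[of i] antimonoD[OF \<open>antimono p\<close>, of i x] x by auto
    qed
    then have "Suc x \<le> card {i. i < length w \<and> w ! i \<ge> p x - \<epsilon>}"
      using card_mono[of "{i. i < length w \<and> w ! i \<ge> p x - \<epsilon>}" "{..x}"] by simp
    also have "\<dots> = card {i. i < length w \<and> rear w ! i \<ge> p x - \<epsilon>}" by (rule count[symmetric])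
    also have "\<dots> \<le> card {..<x}"
    proof (intro card_mono subsetI)
      fix i assume "i \<in> {i. i < length w \<and> rear w ! i \<ge> p x - \<epsilon>}"
      then show "i \<in> {..<x}" using mono[of x i] less by force
    qed simp
    finally show False by simp
  qed
  ultimately show ?thesis by linarith
qed

subsection \<open>The least concave majorant\<close>

lemma convex_hull_cumsum_points:
  "convex hull (fst ` cumsum_points w) = {-1..real (length w) - 1}"
proof
  show "convex hull (fst ` cumsum_points w) \<subseteq> {-1..real (length w) - 1}"
    by (rule hull_minimal) (auto simp: cumsum_points_def)
  have "-1 \<in> fst ` cumsum_points w" "real (length w) - 1 \<in> fst ` cumsum_points w"
    unfolding cumsum_points_def by (force simp: image_iff)+
  then have "closed_segment (-1) (real (length w) - 1) \<subseteq> convex hull (fst ` cumsum_points w)"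
    by (intro convex_contains_segment[THEN iffD1, rule_format] convex_convex_hull hull_inc)
  then show "{-1..real (length w) - 1} \<subseteq> convex hull (fst ` cumsum_points w)"
    by (simp add: closed_segment_eq_real_ivl)
qed

section \<open>Concavity of the majorant and bounds for it\<close>

context
  fixes w :: "real list" and N F L D
  defines "N \<equiv> length w"
    and "F \<equiv> \<lambda>m. \<Sum>i<m. w ! i"
    and "L \<equiv> least_concave_majorant (cumsum_points w)"
    and "D \<equiv> {-1..real (length w) - 1}"
begin

lemma lcmaj_eq_Inf:
  "L t = Inf {g t | g. concave_on D g \<and> (\<forall>m\<le>N. F m \<le> g (real m - 1))}"
proof -
  have "(\<forall>(a, b)\<in>cumsum_points w. b \<le> g a) \<longleftrightarrow> (\<forall>m\<le>N. F m \<le> g (real m - 1))" for g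
    unfolding cumsum_points_def N_def F_def by auto
  then show ?thesis
    unfolding L_def least_concave_majorant_def convex_hull_cumsum_points D_def by simp
qed

lemma grid_in_domain: "m \<le> N \<Longrightarrow> real m - 1 \<in> D"
  by (simp add: D_def N_def)

text \<open>A concave majorant lies above its chord over the whole domain, whose ends have height at
  least \<open>F 0 = 0\<close> and \<open>F N\<close>. This common lower bound makes the real
  infimum genuine.\<close>

lemma concave_majorant_ge:
  assumes g: "concave_on D g" and maj: "\<forall>m\<le>N. F m \<le> g (real m - 1)" and t: "t \<in> D"
  shows "min 0 (F N) \<le> g t"
proof -
  have "t \<in> closed_segment (real 0 - 1) (real N - 1)"
    using t by (simp add: closed_segment_eq_real_ivl D_def N_def)
  then obtain u where u: "0 \<le> u" "u \<le> 1" "t = (1 - u) *\<^sub>R (real 0 - 1) + u *\<^sub>R (real N - 1)"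
    by (auto simp: in_segment)
  have "min 0 (F N) = (1 - u) * min 0 (F N) + u * min 0 (F N)" by (simp add: algebra_simps)
  also have "\<dots> \<le> (1 - u) * g (real 0 - 1) + u * g (real N - 1)"
    using maj[rule_format, of 0] maj[rule_format, of N] u
    by (intro add_mono mult_left_mono) (auto simp: F_def)
  also have "\<dots> \<le> g t"
    unfolding u(3) using u by (intro concave_onD[OF g] grid_in_domain) auto
  finally show ?thesis .
qed

lemma lcmaj_le:
  assumes "concave_on D g" "\<forall>m\<le>N. F m \<le> g (real m - 1)" "t \<in> D"
  shows "L t \<le> g t"
  unfolding lcmaj_eq_Inf
proof (rule cInf_lower)
  show "bdd_below {g t | g. concave_on D g \<and> (\<forall>m\<le>N. F m \<le> g (real m - 1))}"
    using concave_majorant_ge[OF _ _ assms(3)] by (auto intro!: bdd_belowI)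
qed (use assms in blast)

text \<open>All later upper bounds on \<open>L\<close> come from affine majorants. The argument
  \<open>t + 1\<close> turns the abscissa \<open>real m - 1\<close> back into the index
  \<open>m\<close>.\<close>

lemma lcmaj_le_affine:
  assumes "\<And>m. m \<le> N \<Longrightarrow> F m \<le> a + s * real m" "t \<in> D"
  shows "L t \<le> a + s * (t + 1)"
proof (rule lcmaj_le[OF _ _ assms(2)])
  show "concave_on D (\<lambda>t. a + s * (t + 1))"
    unfolding concave_on_iff
  proof (intro conjI ballI allI impI)
    show "convex D" by (simp add: D_def)
    fix x y u v :: real assume "u + v = 1"
    then have v: "v = 1 - u" by simp
    show "u * (a + s * (x + 1)) + v * (a + s * (y + 1)) \<le> a + s * (u *\<^sub>R x + v *\<^sub>R y + 1)"
      unfolding v by (simp add: algebra_simps)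
  qed
qed (use assms(1) in auto)

text \<open>The infimum that defines \<open>L\<close> is over a nonempty set: a constant above all
  partial sums is a majorant.\<close>

lemma ex_concave_majorant: "\<exists>g. concave_on D g \<and> (\<forall>m\<le>N. F m \<le> g (real m - 1))"
proof (intro exI conjI allI impI)
  show "concave_on D (\<lambda>_. \<Sum>i<N. \<bar>w ! i\<bar>)" by (simp add: concave_on_const D_def)
  fix m assume m: "m \<le> N"
  have "F m \<le> (\<Sum>i<m. \<bar>w ! i\<bar>)" unfolding F_def by (rule sum_mono) simp
  also have "\<dots> \<le> (\<Sum>i<N. \<bar>w ! i\<bar>)" using m by (intro sum_mono2) auto
  finally show "F m \<le> (\<Sum>i<N. \<bar>w ! i\<bar>)" .
qed

lemma lcmaj_ge:
  assumes "\<And>g. concave_on D g \<Longrightarrow> \<forall>m\<le>N. F m \<le> g (real m - 1) \<Longrightarrow> c \<le> g t"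
  shows "c \<le> L t"
  unfolding lcmaj_eq_Inf using ex_concave_majorant assms by (intro cInf_greatest) auto

lemma lcmaj_grid_ge: "m \<le> N \<Longrightarrow> F m \<le> L (real m - 1)"
  by (rule lcmaj_ge) auto

text \<open>A pointwise infimum of concave functions is concave: the inequality is checked against
  each majorant \<open>g\<close>.\<close>

lemma concave_on_lcmaj: "concave_on D L"
  unfolding concave_on_iff
proof (intro conjI ballI allI impI)
  show "convex D" by (simp add: D_def)
  fix x y u v :: real assume xy: "x \<in> D" "y \<in> D" "0 \<le> u" "0 \<le> v" "u + v = 1"
  show "u * L x + v * L y \<le> L (u *\<^sub>R x + v *\<^sub>R y)"
  proof (rule lcmaj_ge)
    fix g assume g: "concave_on D g" "\<forall>m\<le>N. F m \<le> g (real m - 1)"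
    have "u * L x + v * L y \<le> u * g x + v * g y"
      using xy g by (intro add_mono mult_left_mono lcmaj_le) auto
    also have "\<dots> \<le> g (u *\<^sub>R x + v *\<^sub>R y)"
      using g(1) xy unfolding concave_on_iff by blast
    finally show "u * L x + v * L y \<le> g (u *\<^sub>R x + v *\<^sub>R y)" .
  qed
qed

text \<open>Concavity at \<open>b\<close> between \<open>a\<close> and \<open>c\<close>, multiplied
  by \<open>c - a\<close> to avoid quotients.\<close>

lemma lcmaj_three_points:
  assumes "a \<in> D" "c \<in> D" "a < b" "b < c"
  shows "(c - b) * L a + (b - a) * L c \<le> (c - a) * L b"
proof -
  define u where "u = (b - a) / (c - a)"
  have u: "0 \<le> u" "u \<le> 1" and cu: "(c - a) * u = b - a"
    using assms by (auto simp: u_def)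
  have b: "(1 - u) *\<^sub>R a + u *\<^sub>R c = b" using cu by (simp add: algebra_simps)
  have "(1 - u) * L a + u * L c \<le> L b"
    using concave_onD[OF concave_on_lcmaj u assms(1,2)] by (simp only: b)
  then have "(c - a) * ((1 - u) * L a + u * L c) \<le> (c - a) * L b"
    using assms by (intro mult_left_mono) auto
  also have "(c - a) * ((1 - u) * L a + u * L c) = (c - a - (c - a) * u) * L a + (c - a) * u * L c"
    by (simp add: algebra_simps)
  finally show ?thesis unfolding cu by simp
qed

text \<open>Cells have length 1, so this is the chord slope of \<open>L\<close> over the cell ending
  at \<open>real m\<close>.\<close>

definition "grid_slope m = L (real m) - L (real m - 1)"

lemma lcmaj_grid_le_line:
  assumes "m < N" "j \<le> N"
  shows "L (real j - 1) \<le> L (real m - 1) + grid_slope m * (real j - real m)"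
proof -
  have D: "real m - 1 \<in> D" "real m \<in> D" "real j - 1 \<in> D"
    using assms grid_in_domain[of m] grid_in_domain[of "Suc m"] grid_in_domain[of j] by auto
  \<comment> \<open>The line meets \<open>L\<close> at both ends of the cell, the first two cases;
    on either side of the cell the three-point inequality applies.\<close>
  consider "j = m" | "j = Suc m" | "j < m" | "Suc m < j" by linarith
  then show ?thesis
  proof cases
    case 3
    then show ?thesis using lcmaj_three_points[OF D(3,2), of "real m - 1"]
      by (simp add: grid_slope_def algebra_simps)
  next
    case 4
    then show ?thesis using lcmaj_three_points[OF D(1,3), of "real m"]
      by (simp add: grid_slope_def algebra_simps)
  qed (auto simp: grid_slope_def)
qed

text \<open>
  By concavity, the chord of \<open>L\<close> over one grid cell dominates \<open>L\<close> at every other grid point, so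
  the affine function extending it is itself a majorant of the points and bounds \<open>L\<close> from above.
\<close>

lemma lcmaj_linear_between:
  assumes "m < N" "real m - 1 < t" "t < real m"
  shows "L t = L (real m - 1) + grid_slope m * (t - (real m - 1))"
proof (rule antisym)
  have D: "real m - 1 \<in> D" "real m \<in> D"
    using assms grid_in_domain[of m] grid_in_domain[of "Suc m"] by auto
  then have t: "t \<in> D" using assms by (auto simp: D_def)
  \<comment> \<open>The intercept is the value of the chord's line at the abscissa -1, that is, at
    index 0.\<close>
  have "L t \<le> (L (real m - 1) - grid_slope m * real m) + grid_slope m * (t + 1)"
    using lcmaj_grid_ge lcmaj_grid_le_line[OF assms(1)]
    by (intro lcmaj_le_affine t) (force simp: algebra_simps)
  then show "L t \<le> L (real m - 1) + grid_slope m * (t - (real m - 1))"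
    by (simp add: algebra_simps)
  show "L (real m - 1) + grid_slope m * (t - (real m - 1)) \<le> L t"
    using lcmaj_three_points[OF D assms(2,3)] by (simp add: grid_slope_def algebra_simps)
qed

text \<open>\<open>L\<close> is affine on the cell to the left of \<open>real m\<close>, so the
  difference quotients are constant there and the limit is immediate.\<close>

lemma left_slope_lcmaj:
  assumes "m < N"
  shows "left_slope L (real m) = grid_slope m"
proof -
  have "\<forall>\<^sub>F s in at_left (real m). grid_slope m = (L (real m) - L s) / (real m - s)"
    using eventually_at_left_real[of "real m - 1" "real m", simplified]
  proof eventually_elim
    case (elim s)
    have "L (real m) - L s = grid_slope m * (real m - s)"
      using lcmaj_linear_between[OF assms, of s] elim by (simp add: grid_slope_def algebra_simps)
    then show ?case using elim by simp
  qed
  then have "((\<lambda>s. (L (real m) - L s) / (real m - s)) \<longlongrightarrow> grid_slope m) (at_left (real m))"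
    by (rule Lim_transform_eventually[OF tendsto_const])
  then show ?thesis unfolding left_slope_def by (intro tendsto_Lim) auto
qed

section \<open>Sign, total and accuracy of the Grenander vector\<close>

lemma length_gren: "length (gren w) = N"
  by (simp add: gren_def N_def)

lemma nth_gren: "m < N \<Longrightarrow> gren w ! m = grid_slope m"
  using left_slope_lcmaj by (simp add: gren_def N_def L_def)

text \<open>The line from \<open>(-1, 0)\<close> with slope \<open>s\<close>, the sum of all
  \<open>\<bar>w ! i\<bar>\<close>, is a majorant: \<open>F m \<le> s \<le> s * real m\<close> once
  \<open>m\<close> is positive.\<close>

lemma lcmaj_left_end: "L (-1) = 0"
proof (rule antisym)
  define s where "s = (\<Sum>i<N. \<bar>w ! i\<bar>)"
  have "F m \<le> 0 + s * real m" if "m \<le> N" for m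
  proof (cases "m = 0")
    case False
    have "F m \<le> (\<Sum>i<m. \<bar>w ! i\<bar>)" unfolding F_def by (rule sum_mono) simp
    also have "\<dots> \<le> s" unfolding s_def using that by (intro sum_mono2) auto
    also have "\<dots> \<le> s * real m"
      using False mult_left_mono[of 1 "real m" s] by (auto simp: s_def sum_nonneg)
    finally show ?thesis by simp
  qed (simp add: F_def)
  then have "L (-1) \<le> 0 + s * (-1 + 1)"
    by (rule lcmaj_le_affine) (simp_all add: D_def)
  then show "L (-1) \<le> 0" by simp
  show "0 \<le> L (-1)" using lcmaj_grid_ge[of 0] by (simp add: F_def)
qed

text \<open>For nonnegative entries the partial sums increase, so the constant \<open>F N\<close> is
  a majorant.\<close>

lemma lcmaj_le_total:
  assumes "\<And>i. i < N \<Longrightarrow> 0 \<le> w ! i" "t \<in> D"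
  shows "L t \<le> F N"
proof -
  have "F m \<le> F N + 0 * real m" if "m \<le> N" for m
    unfolding F_def using assms(1) that by (auto intro!: sum_mono2)
  from lcmaj_le_affine[OF this assms(2)] show ?thesis by simp
qed

lemma lcmaj_right_end:
  assumes "\<And>i. i < N \<Longrightarrow> 0 \<le> w ! i"
  shows "L (real N - 1) = F N"
  using lcmaj_le_total[OF assms] lcmaj_grid_ge[of N] grid_in_domain[of N] by (simp add: antisym)

text \<open>The line through the chord starts at height at most \<open>F N\<close> and has reached
  at least \<open>F N\<close> at the right end, so it cannot descend.\<close>

lemma gren_nonneg:
  assumes w: "\<And>i. i < N \<Longrightarrow> 0 \<le> w ! i" and "m < N"
  shows "0 \<le> gren w ! m"
proof -
  have "F N \<le> L (real m - 1) + grid_slope m * (real N - real m)"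
    using lcmaj_grid_le_line[OF assms(2), of N] lcmaj_right_end[OF w] by simp
  also have "L (real m - 1) \<le> F N" using assms by (intro lcmaj_le_total grid_in_domain) auto
  finally have "0 \<le> grid_slope m * (real N - real m)" by simp
  then show ?thesis using assms(2) by (simp add: nth_gren zero_le_mult_iff)
qed

text \<open>The slopes are increments of \<open>L\<close>, so they telescope to the difference of
  its end values \<open>F N\<close> and 0.\<close>

lemma sum_list_gren:
  assumes "\<And>i. i < N \<Longrightarrow> 0 \<le> w ! i"
  shows "sum_list (gren w) = sum_list w"
proof -
  have "sum_list (gren w) = (\<Sum>m<N. L (real (Suc m) - 1) - L (real m - 1))"
    by (simp add: sum_list_sum_nth length_gren atLeast0LessThan nth_gren grid_slope_def)
  also have "\<dots> = L (real N - 1) - L (-1)"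
    using sum_lessThan_telescope[of "\<lambda>m. L (real m - 1)" N] by simp
  also have "\<dots> = sum_list w"
    by (simp add: lcmaj_right_end[OF assms] lcmaj_left_end) (simp add: F_def N_def sum_list_sum_nth atLeast0LessThan)
  finally show ?thesis .
qed

text \<open>
  Marshall's lemma. The upper bound uses, at each grid point, a supporting line of the concave
  partial sums of \<open>p\<close>, shifted up by \<open>\<delta>\<close>.
\<close>

lemma lcmaj_close_to_concave:
  assumes "antimono p" and close: "\<And>m. m \<le> N \<Longrightarrow> \<bar>F m - (\<Sum>i<m. p i)\<bar> \<le> \<delta>" and m: "m \<le> N"
  shows "\<bar>L (real m - 1) - (\<Sum>i<m. p i)\<bar> \<le> \<delta>"
proof -
  define P where "P m = (\<Sum>i<m. p i)" for m
  \<comment> \<open>Increments of \<open>P\<close> from \<open>j\<close> on are at most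
    \<open>p j\<close>, and those before \<open>j + d\<close> are at least \<open>p (j + d)\<close>;
    these are the two sides of the supporting line.\<close>
  have up: "P (j + d) \<le> P j + p j * real d" for j d
  proof (induction d)
    case (Suc d)
    then show ?case using antimonoD[OF assms(1), of j "j + d"] by (simp add: P_def algebra_simps)
  qed simp
  have down: "P j \<le> P (j + d) - p (j + d) * real d" for j d
  proof (induction d)
    case (Suc d)
    have "p (j + Suc d) * real (Suc d) \<le> p (j + d) * real d + p (j + d)"
      using mult_right_mono[OF antimonoD[OF assms(1), of "j + d" "j + Suc d"], of "real (Suc d)"]
      by (simp add: algebra_simps)
    then show ?case using Suc by (simp add: P_def)
  qed simp
  have tangent: "P j \<le> P m + p m * (real j - real m)" for j
    using up[of m "j - m"] down[of j "m - j"] by (cases "m \<le> j") (auto simp: algebra_simps)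
  have "F j \<le> (P m - p m * real m + \<delta>) + p m * real j" if "j \<le> N" for j
    using tangent[of j] close[OF that] by (simp add: P_def[symmetric] algebra_simps)
  from lcmaj_le_affine[OF this grid_in_domain[OF m]]
  have "L (real m - 1) \<le> P m + \<delta>" by simp
  \<comment> \<open>The lower bound holds because \<open>L\<close> dominates \<open>F\<close>, which
    is within \<open>\<delta>\<close> of \<open>P\<close>.\<close>
  then show ?thesis using lcmaj_grid_ge[OF m] close[OF m] unfolding P_def by linarith
qed

text \<open>Each slope is a difference of two grid values of \<open>L\<close>, and each of these is
  off by at most \<open>\<delta>\<close>.\<close>

lemma gren_close:
  assumes "antimono p" and close: "\<And>m. m \<le> N \<Longrightarrow> \<bar>F m - (\<Sum>i<m. p i)\<bar> \<le> \<delta>" and x: "x < N"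
  shows "\<bar>gren w ! x - p x\<bar> \<le> 2 * \<delta>"
  using lcmaj_close_to_concave[OF assms(1) close, of x] lcmaj_close_to_concave[OF assms(1) close, of "Suc x"] x
  by (simp add: nth_gren grid_slope_def)

end

subsection \<open>The three estimators\<close>

lemma extend_zero_sums: "extend_zero w sums sum_list w"
  using sums_finite[of "{..<length w}" "extend_zero w"]
  by (simp add: extend_zero_def sum_list_sum_nth atLeast0LessThan)

lemma extend_zero_nonneg: "(\<And>i. i < length w \<Longrightarrow> 0 \<le> w ! i) \<Longrightarrow> 0 \<le> extend_zero w x"
  by (simp add: extend_zero_def)

text \<open>Within the list \<open>rear_close\<close> applies with the l1 error as
  \<open>\<epsilon>\<close>; beyond it both extensions vanish and have the same error.\<close>

lemma extend_zero_rear_close: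
  assumes "antimono p" and s: "summable (\<lambda>x. \<bar>extend_zero w x - p x\<bar>)"
  shows "\<bar>extend_zero (rear w) x - p x\<bar> \<le> (\<Sum>x. \<bar>extend_zero w x - p x\<bar>)"
proof -
  have le: "\<bar>extend_zero w i - p i\<bar> \<le> (\<Sum>x. \<bar>extend_zero w x - p x\<bar>)" for i
    using sum_le_suminf[OF s, of "{i}"] by simp
  have len: "length (rear w) = length w" by (simp add: rear_def)
  show ?thesis
  proof (cases "x < length w")
    case True
    have "\<bar>w ! i - p i\<bar> \<le> (\<Sum>x. \<bar>extend_zero w x - p x\<bar>)" if "i < length w" for i
      using le[of i] that by (simp add: extend_zero_def)
    from rear_close[OF assms(1) this True] show ?thesis
      using True len by (simp add: extend_zero_def)
  next
    case False
    then have "extend_zero (rear w) x = extend_zero w x" by (simp add: extend_zero_def len)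
    then show ?thesis using le[of x] by simp
  qed
qed

lemma extend_zero_gren_close:
  assumes "antimono p" and s: "summable (\<lambda>x. \<bar>extend_zero w x - p x\<bar>)"
  shows "\<bar>extend_zero (gren w) x - p x\<bar> \<le> 2 * (\<Sum>x. \<bar>extend_zero w x - p x\<bar>)"
proof (cases "x < length w")
  case True
  \<comment> \<open>The l1 error bounds the error of every partial sum, so it can serve as
    \<open>\<delta>\<close>.\<close>
  have "\<bar>(\<Sum>i<m. w ! i) - (\<Sum>i<m. p i)\<bar> \<le> (\<Sum>x. \<bar>extend_zero w x - p x\<bar>)" if "m \<le> length w" for m
  proof -
    have "(\<Sum>i<m. w ! i) - (\<Sum>i<m. p i) = (\<Sum>i<m. extend_zero w i - p i)"
      using that by (simp add: sum_subtractf extend_zero_def)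
    also have "\<bar>\<dots>\<bar> \<le> (\<Sum>i<m. \<bar>extend_zero w i - p i\<bar>)" by (rule sum_abs)
    also have "\<dots> \<le> (\<Sum>x. \<bar>extend_zero w x - p x\<bar>)" by (rule sum_le_suminf[OF s]) auto
    finally show ?thesis .
  qed
  from gren_close[OF assms(1) this True] show ?thesis
    using True by (simp add: extend_zero_def length_gren)
next
  case False
  then have "\<bar>extend_zero (gren w) x - p x\<bar> = \<bar>extend_zero w x - p x\<bar>"
    by (simp add: extend_zero_def length_gren)
  also have "\<dots> \<le> (\<Sum>x. \<bar>extend_zero w x - p x\<bar>)"
    using sum_le_suminf[OF s, of "{x}"] by simp
  also have "\<dots> \<le> 2 * (\<Sum>x. \<bar>extend_zero w x - p x\<bar>)"
    using suminf_nonneg[OF s] by simp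
  finally show ?thesis .
qed

lemma extend_zero_empirical_vec:
  assumes "n \<ge> 1"
  shows "extend_zero (empirical_vec n xs) = empirical n xs"
proof
  fix x
  have "empirical n xs x = 0" if "Max (xs ` {1..n}) < x"
  proof -
    have "{i \<in> {1..n}. xs i = x} = {}"
      using that Max_ge[of "xs ` {1..n}"] by force
    then show ?thesis by (simp add: empirical_def)
  qed
  then show "extend_zero (empirical_vec n xs) x = empirical n xs x"
    by (auto simp: extend_zero_def empirical_vec_def nth_append simp del: upt_Suc)
qed

text \<open>Grouping the \<open>n\<close> sample indices by observed value counts each of them
  once.\<close>

lemma sum_list_empirical_vec:
  assumes "n \<ge> 1"
  shows "sum_list (empirical_vec n xs) = 1"
proof -
  have "(\<Sum>x\<in>{..<Suc (Max (xs ` {1..n}))}. \<Sum>i\<in>{i \<in> {1..n}. xs i = x}. 1) = (\<Sum>i\<in>{1..n}. 1::real)"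
    by (rule sum.group) (auto simp: less_Suc_eq_le)
  then show ?thesis
    using assms
    by (simp add: empirical_vec_def interv_sum_list_conv_sum_set_nat empirical_def
        atLeast0LessThan sum_divide_distrib[symmetric] del: upt_Suc sum.lessThan_Suc)
qed

lemma empirical_vec_nonneg: "i < length (empirical_vec n xs) \<Longrightarrow> 0 \<le> empirical_vec n xs ! i"
  by (simp add: empirical_vec_def empirical_def del: upt_Suc)

lemma pmf_nat_sums: "pmf p sums 1"
  for p :: "nat pmf"
  using sums_integral_count_space_nat[OF integrable_pmf[of UNIV p]] by (simp add: integral_pmf)

text \<open>Sorting permutes the entries, and the Grenander slopes keep sign and total. This
  supplies the hypotheses of \<open>tendsto_l1_of_pointwise\<close>.\<close>

lemma estimator_pmf:
  assumes "n \<ge> 1" "est \<in> {empirical, grenander, rearrangement}"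
  shows "(\<forall>x. 0 \<le> est n xs x) \<and> est n xs sums 1"
proof -
  define w where "w = empirical_vec n xs"
  have w: "\<And>i. i < length w \<Longrightarrow> 0 \<le> w ! i" "sum_list w = 1"
    using empirical_vec_nonneg sum_list_empirical_vec assms(1) unfolding w_def by auto
  have "set (rear w) = set w" "sum_list (rear w) = sum_list w"
    by (simp_all add: rear_def flip: sum_mset_sum_list)
  then have rear: "\<forall>x. 0 \<le> extend_zero (rear w) x" "extend_zero (rear w) sums 1"
    using w extend_zero_sums[of "rear w"]
    by (auto intro!: extend_zero_nonneg simp: in_set_conv_nth all_set_conv_all_nth[symmetric])
      (metis in_set_conv_nth nth_mem)
  have gren: "\<forall>x. 0 \<le> extend_zero (gren w) x" "extend_zero (gren w) sums 1"
    using w extend_zero_sums[of "gren w"] gren_nonneg[of w] sum_list_gren[of w]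
    by (auto intro!: extend_zero_nonneg simp: length_gren)
  show ?thesis
    using assms rear gren extend_zero_sums[of w] extend_zero_nonneg[of w] w
      extend_zero_empirical_vec[OF assms(1), of xs]
    by (auto simp: rearrangement_def grenander_def w_def)
qed

lemma summable_estimator_diff:
  fixes p :: "nat pmf"
  assumes "n \<ge> 1" "est \<in> {empirical, grenander, rearrangement}"
  shows "summable (\<lambda>x. \<bar>est n xs x - pmf p x\<bar>)"
proof (rule summable_comparison_test'[where N = 0])
  show "summable (\<lambda>x. est n xs x + pmf p x)"
    using estimator_pmf[OF assms, of xs] pmf_nat_sums[of p]
    by (intro summable_add) (auto intro: sums_summable)
qed (use estimator_pmf[OF assms, of xs] in \<open>simp add: abs_diff_le_iff\<close>)

lemma estimator_tendsto_l1:
  fixes p :: "nat pmf"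
  assumes "antimono (pmf p)" and lim: "\<And>x. (\<lambda>n. empirical n xs x) \<longlonglongrightarrow> pmf p x"
    and est: "est \<in> {empirical, grenander, rearrangement}"
  shows "(\<lambda>n. \<Sum>x. \<bar>est n xs x - pmf p x\<bar>) \<longlonglongrightarrow> 0"
proof -
  \<comment> \<open>Stated for arbitrary \<open>e\<close> because it is used twice: for
    \<open>empirical\<close>, and then for \<open>est\<close> once its pointwise limit is
    known.\<close>
  have scheffe: "(\<lambda>n. \<Sum>x. \<bar>e n xs x - pmf p x\<bar>) \<longlonglongrightarrow> 0"
    if "e \<in> {empirical, grenander, rearrangement}" "\<And>x. (\<lambda>n. e n xs x) \<longlonglongrightarrow> pmf p x" for e
  proof (rule tendsto_l1_of_pointwise[OF _ _ pmf_nonneg pmf_nat_sums that(2)])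
    show "\<forall>\<^sub>F n in sequentially. \<forall>x. 0 \<le> e n xs x" "\<forall>\<^sub>F n in sequentially. e n xs sums 1"
      using estimator_pmf[OF _ that(1)] by (auto intro!: eventually_sequentiallyI[of 1])
  qed
  define d where "d n = (\<Sum>x. \<bar>empirical n xs x - pmf p x\<bar>)" for n
  have "d \<longlonglongrightarrow> 0" unfolding d_def by (rule scheffe) (simp_all add: lim)
  then have d2: "(\<lambda>n. 2 * d n) \<longlonglongrightarrow> 0" by (rule tendsto_mult_right_zero)
  \<comment> \<open>The factor 2 comes from \<open>grenander\<close> and covers the other two
    estimators as well.\<close>
  have "\<bar>est n xs x - pmf p x\<bar> \<le> 2 * d n" if n: "n \<ge> 1" for n x
  proof -
    have ext: "extend_zero (empirical_vec n xs) = empirical n xs"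
      using n by (rule extend_zero_empirical_vec)
    have s: "summable (\<lambda>x. \<bar>extend_zero (empirical_vec n xs) x - pmf p x\<bar>)"
      unfolding ext using n by (rule summable_estimator_diff) simp
    have "\<bar>empirical n xs x - pmf p x\<bar> \<le> d n"
      using sum_le_suminf[OF s, of "{x}"] by (simp add: ext d_def)
    then show ?thesis
      using extend_zero_rear_close[OF assms(1) s, of x] extend_zero_gren_close[OF assms(1) s, of x] est
      by (auto simp: rearrangement_def grenander_def ext d_def)
  qed
  then have "(\<lambda>n. est n xs x - pmf p x) \<longlonglongrightarrow> 0" for x
    by (intro Lim_null_comparison[OF _ d2] eventually_sequentiallyI[of 1]) simp
  then show ?thesis by (intro scheffe est) (simp add: LIM_zero_iff)
qed

theorem theorem2p4:
  fixes M :: "'a measure" and X :: "nat \<Rightarrow> 'a \<Rightarrow> nat" and p :: "nat pmf"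
    and est :: "nat \<Rightarrow> (nat \<Rightarrow> nat) \<Rightarrow> nat \<Rightarrow> real"
  assumes "prob_space M"
    and "prob_space.indep_vars M (\<lambda>_. count_space UNIV) X {1..}"
    and "\<And>i. i \<ge> 1 \<Longrightarrow> distr M (count_space UNIV) (X i) = measure_pmf p"
    and "\<And>x. pmf p x \<ge> pmf p (x + 1)"
    and "est \<in> {empirical, grenander, rearrangement}"
  shows "(AE \<omega> in M. (\<lambda>n. hellinger (est n (\<lambda>i. X i \<omega>)) (pmf p)) \<longlonglongrightarrow> 0) \<and>
    (\<forall>k::ereal. 1 \<le> k \<longrightarrow>
      (AE \<omega> in M. (\<lambda>n. lk_norm k (\<lambda>x. est n (\<lambda>i. X i \<omega>) x - pmf p x)) \<longlonglongrightarrow> 0))"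
proof -
  have anti: "antimono (pmf p)" using assms(4) by (simp add: antimono_iff_le_Suc)
  \<comment> \<open>This part is deterministic: pointwise convergence along one sample path yields
    every metric, so a single null set serves all \<open>k\<close>.\<close>
  have limits: "(\<lambda>n. hellinger (est n xs) (pmf p)) \<longlonglongrightarrow> 0 \<and>
      (\<forall>k::ereal. 1 \<le> k \<longrightarrow> (\<lambda>n. lk_norm k (\<lambda>x. est n xs x - pmf p x)) \<longlonglongrightarrow> 0)"
    if "\<forall>x. (\<lambda>n. empirical n xs x) \<longlonglongrightarrow> pmf p x" for xs
  proof (intro conjI allI impI)
    have l1: "(\<lambda>n. \<Sum>x. \<bar>est n xs x - pmf p x\<bar>) \<longlonglongrightarrow> 0"
      by (rule estimator_tendsto_l1[OF anti that[rule_format] assms(5)])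
    have s: "summable (\<lambda>x. \<bar>est n xs x - pmf p x\<bar>)" if "n \<ge> 1" for n
      using that assms(5) by (rule summable_estimator_diff)
    show "(\<lambda>n. hellinger (est n xs) (pmf p)) \<longlonglongrightarrow> 0"
    proof (rule Lim_null_comparison)
      show "(\<lambda>n. sqrt (\<Sum>x. \<bar>est n xs x - pmf p x\<bar>)) \<longlonglongrightarrow> 0"
        using tendsto_real_sqrt[OF l1] by simp
      show "\<forall>\<^sub>F n in sequentially. norm (hellinger (est n xs) (pmf p))
          \<le> sqrt (\<Sum>x. \<bar>est n xs x - pmf p x\<bar>)"
        using hellinger_le_l1[OF _ _ s] estimator_pmf[OF _ assms(5)]
        by (intro eventually_sequentiallyI[of 1]) simp
    qed
    show "(\<lambda>n. lk_norm k (\<lambda>x. est n xs x - pmf p x)) \<longlonglongrightarrow> 0" if "1 \<le> k" for k :: ereal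
      using lk_norm_le_l1[OF s that]
      by (intro Lim_null_comparison[OF _ l1] eventually_sequentiallyI[of 1]) simp
  qed
  have "AE \<omega> in M. \<forall>x. (\<lambda>n. empirical n (\<lambda>i. X i \<omega>) x) \<longlonglongrightarrow> pmf p x"
    by (rule empirical_tendsto_AE[OF assms(1,2,3)])
  then show ?thesis
    using limits by (auto elim!: eventually_mono)
qed

end
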